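(* Let $x_1,\dots,x_n$ be a sample of positive real numbers with coefficient of variation $CV>1$. Then the profile log-likelihood function $\ell_p$ of the Lomax distribution $LM(\alpha,\sigma)$ for this sample has a global maximum at a finite point; that is, there exists $\sigma^*\in(0,\infty)$ such that $\ell_p(\sigma)\le \ell_p(\sigma^* )$ for all $\sigma\in(0,\infty)$.
   Context: The Lomax distribution $LM(\alpha,\sigma)$, $\alpha,\sigma>0$, has density $f(z)=\frac{\alpha}{\sigma}\left(1+\frac{z}{\sigma}\right)^{-\alpha-1}$, $z\ge 0$. For a sample $x_1,\dots,x_n$, the log-likelihood divided by $n$ is $$\ell(\alpha,\sigma)=\log\alpha-\log\sigma-\frac{\alpha+1}{n}\sum_{i=1}^n\log\left(1+\frac{x_i}{\sigma}\right).$$ For fixed $\sigma>0$ it is maximized over $\alpha$ at $\alpha(\sigma)=\frac{n}{\sum_{i=1}^n\log(1+x_i/\sigma)}$, and the profile log-likelihood function is $$\ell_p(\sigma)=\ell(\alpha(\sigma),\sigma)=\log\alpha(\sigma)-\log\sigma-1-\frac{1}{\alpha(\sigma)},\qquad \sigma>0.$$ The coefficient of variation is $CV=s/\mu$, where $\mu=\frac1n\sum_{i=1}^n x_i$ and $s=\sqrt{\frac1n\sum_{i=1}^n x_i^2-\mu^2}$. *)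

theory Defs
  imports "HOL-Analysis.Analysis"
begin

text \<open>A sample of size \<open>n\<close> is a sequence \<open>x\<close> of which only the entries
  \<open>x 1, \<dots>, x n\<close> are used.\<close>

definition lomax_density :: "real \<Rightarrow> real \<Rightarrow> real \<Rightarrow> real" where
  "lomax_density \<alpha> \<sigma> z =
    (if 0 \<le> z then \<alpha> / \<sigma> * (1 + z / \<sigma>) powr (- \<alpha> - 1) else 0)"

text \<open>The log-likelihood is normalised by the sample size.\<close>

definition lomax_loglik :: "nat \<Rightarrow> (nat \<Rightarrow> real) \<Rightarrow> real \<Rightarrow> real \<Rightarrow> real" where
  "lomax_loglik n x \<alpha> \<sigma> = 1 / real n * (\<Sum>i = 1..n. ln (lomax_density \<alpha> \<sigma> (x i)))"

definition lomax_alpha :: "nat \<Rightarrow> (nat \<Rightarrow> real) \<Rightarrow> real \<Rightarrow> real" where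
  "lomax_alpha n x \<sigma> = real n / (\<Sum>i = 1..n. ln (1 + x i / \<sigma>))"

definition lomax_profile_loglik :: "nat \<Rightarrow> (nat \<Rightarrow> real) \<Rightarrow> real \<Rightarrow> real" where
  "lomax_profile_loglik n x \<sigma> = lomax_loglik n x (lomax_alpha n x \<sigma>) \<sigma>"

definition sample_mean :: "nat \<Rightarrow> (nat \<Rightarrow> real) \<Rightarrow> real" where
  "sample_mean n x = 1 / real n * (\<Sum>i = 1..n. x i)"

text \<open>The variance is the biased one, with divisor \<open>n\<close>.\<close>

definition sample_sd :: "nat \<Rightarrow> (nat \<Rightarrow> real) \<Rightarrow> real" where
  "sample_sd n x = sqrt (1 / real n * (\<Sum>i = 1..n. (x i)\<^sup>2) - (sample_mean n x)\<^sup>2)"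

definition coeff_var :: "nat \<Rightarrow> (nat \<Rightarrow> real) \<Rightarrow> real" where
  "coeff_var n x = sample_sd n x / sample_mean n x"

lemma lomax_loglik_eq:
  assumes "n \<ge> 1" and "\<forall>i \<in> {1..n}. x i > 0" and "\<alpha> > 0" and "\<sigma> > 0"
  shows "lomax_loglik n x \<alpha> \<sigma> =
    ln \<alpha> - ln \<sigma> - (\<alpha> + 1) / real n * (\<Sum>i = 1..n. ln (1 + x i / \<sigma>))"
proof -
  have "ln (lomax_density \<alpha> \<sigma> (x i)) = (ln \<alpha> - ln \<sigma>) - (\<alpha> + 1) * ln (1 + x i / \<sigma>)"
    if "i \<in> {1..n}" for i
  proof -
    have "x i > 0" using assms(2) that by blast
    then have pos: "1 + x i / \<sigma> > 0" using assms(4) by (simp add: add_pos_pos)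
    have "ln (lomax_density \<alpha> \<sigma> (x i)) = ln (\<alpha> / \<sigma>) + ln ((1 + x i / \<sigma>) powr (- \<alpha> - 1))"
      using \<open>x i > 0\<close> pos assms(3,4)
      by (subst ln_mult_pos [symmetric]) (auto simp: lomax_density_def)
    also have "\<dots> = (ln \<alpha> - ln \<sigma>) + (- \<alpha> - 1) * ln (1 + x i / \<sigma>)"
      using pos assms(3,4) by (simp add: ln_div ln_powr)
    finally show ?thesis by (simp add: algebra_simps)
  qed
  then have "(\<Sum>i = 1..n. ln (lomax_density \<alpha> \<sigma> (x i))) =
      real n * (ln \<alpha> - ln \<sigma>) - (\<alpha> + 1) * (\<Sum>i = 1..n. ln (1 + x i / \<sigma>))"
    by (simp add: sum_subtractf sum_distrib_left)
  then show ?thesis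
    using assms(1) by (simp add: lomax_loglik_def field_simps)
qed

lemma lomax_alpha_pos:
  assumes "n \<ge> 1" and "\<forall>i \<in> {1..n}. x i > 0" and "\<sigma> > 0"
  shows "lomax_alpha n x \<sigma> > 0"
proof -
  have "(\<Sum>i = 1..n. ln (1 + x i / \<sigma>)) > 0"
    using assms by (intro sum_pos ln_gt_zero) auto
  then show ?thesis using assms(1) by (simp add: lomax_alpha_def)
qed

lemma lomax_profile_loglik_eq:
  assumes "n \<ge> 1" and "\<forall>i \<in> {1..n}. x i > 0" and "\<sigma> > 0"
  shows "lomax_profile_loglik n x \<sigma> =
    ln (lomax_alpha n x \<sigma>) - ln \<sigma> - 1 - 1 / lomax_alpha n x \<sigma>"
proof -
  let ?a = "lomax_alpha n x \<sigma>"
  let ?S = "\<Sum>i = 1..n. ln (1 + x i / \<sigma>)"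
  have a: "?a > 0" using lomax_alpha_pos[OF assms] .
  then have S: "?S = real n / ?a"
    by (auto simp: lomax_alpha_def)
  have "(?a + 1) / real n * ?S = 1 + 1 / ?a"
    unfolding S using a assms(1) by (simp add: field_simps)
  then show ?thesis
    using lomax_loglik_eq[OF assms(1,2) a assms(3)]
    by (simp add: lomax_profile_loglik_def)
qed

lemma lomax_alpha_maximizes:
  assumes "n \<ge> 1" and "\<forall>i \<in> {1..n}. x i > 0" and "\<alpha> > 0" and "\<sigma> > 0"
  shows "lomax_loglik n x \<alpha> \<sigma> \<le> lomax_loglik n x (lomax_alpha n x \<sigma>) \<sigma>"
proof -
  let ?a = "lomax_alpha n x \<sigma>"
  let ?S = "\<Sum>i = 1..n. ln (1 + x i / \<sigma>)"
  have a: "?a > 0" using lomax_alpha_pos[OF assms(1,2,4)] .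
  then have S: "?S = real n / ?a"
    by (auto simp: lomax_alpha_def)
  have "(\<alpha> + 1) / real n * ?S = \<alpha> / ?a + 1 / ?a"
    unfolding S using a assms(1) by (simp add: field_simps)
  then have l: "lomax_loglik n x \<alpha> \<sigma> = ln \<alpha> - ln \<sigma> - \<alpha> / ?a - 1 / ?a"
    using lomax_loglik_eq[OF assms] by linarith
  have "ln (\<alpha> / ?a) \<le> \<alpha> / ?a - 1"
    using a assms(3) by (intro ln_le_minus_one) simp
  then have "ln \<alpha> - ln ?a \<le> \<alpha> / ?a - 1"
    using a assms(3) by (simp add: ln_div)
  then show ?thesis
    using l lomax_profile_loglik_eq[OF assms(1,2,4)]
    by (simp add: lomax_profile_loglik_def)
qed

end

theory Submission
  imports Defs "HOL-Real_Asymp.Real_Asymp"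
begin

text \<open>Write \<open>M \<sigma>\<close> for the mean of the \<open>ln (1 + x i / \<sigma>)\<close>, so that the profile log-likelihood is
  \<open>- ln (\<sigma> * M \<sigma>) - 1 - M \<sigma>\<close>. At \<open>0\<close> the sum \<open>ln \<sigma> + M \<sigma>\<close> stays bounded below while
  \<open>M \<sigma>\<close> diverges, so the profile tends to \<open>-\<infinity>\<close>. At \<open>\<infinity>\<close> it tends to \<open>- ln \<mu> - 1\<close>. With \<open>q\<close> the
  mean of the squares, \<open>\<sigma> * (\<sigma> * M \<sigma> - \<mu>)\<close> tends to \<open>- q / 2\<close>, so up to \<open>o (1 / \<sigma>)\<close> the profile
  exceeds that limit by \<open>(q / (2 * \<mu>) - \<mu>) / \<sigma>\<close>. This is positive because \<open>CV > 1\<close> means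
  \<open>q > 2 * \<mu>\<^sup>2\<close>. Hence the limits at both ends are beaten at some point, and compactness gives
  the maximum.\<close>

text \<open>Near both ends \<open>f\<close> stays below its value at \<open>a\<close>, so a maximum
  over a compact interval that contains \<open>a\<close> and reaches into both end regions is
  global.\<close>

lemma continuous_attains_sup_greaterThan:
  fixes f :: "real \<Rightarrow> real"
  assumes cont: "continuous_on {b<..} f" and "b < a"
    and left: "\<forall>\<^sub>F s in at_right b. f s \<le> f a"
    and right: "\<forall>\<^sub>F s in at_top. f s \<le> f a"
  shows "\<exists>m\<in>{b<..}. \<forall>s\<in>{b<..}. f s \<le> f m"
proof -
  obtain d where d: "d > b" "\<And>s. b < s \<Longrightarrow> s < d \<Longrightarrow> f s \<le> f a"
    using left by (auto simp: eventually_at_right_field)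
  obtain N where N: "\<And>s. s \<ge> N \<Longrightarrow> f s \<le> f a"
    using right by (auto simp: eventually_at_top_linorder)
  \<comment> \<open>Taking \<open>min\<close> and \<open>max\<close> with \<open>a\<close> keeps
    \<open>a\<close> in the interval wherever it lies relative to \<open>d\<close> and
    \<open>N\<close>.\<close>
  define I where "I = {min a d..max a N}"
  have "compact I" "a \<in> I" and I: "I \<subseteq> {b<..}"
    using d(1) \<open>b < a\<close> by (auto simp: I_def)
  moreover have "continuous_on I f"
    using cont I by (rule continuous_on_subset)
  ultimately obtain m where m: "m \<in> I" "\<And>s. s \<in> I \<Longrightarrow> f s \<le> f m"
    using continuous_attains_sup[of I f] by blast
  have "f s \<le> f m" if "s > b" for s
  proof (cases "s \<in> I")
    case False
    then have "s < d \<or> s \<ge> N" by (auto simp: I_def)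
    then have "f s \<le> f a" using d(2) N that by blast
    then show ?thesis using m(2)[OF \<open>a \<in> I\<close>] by linarith
  qed (rule m(2))
  then show ?thesis using m(1) I by blast
qed

text \<open>The reciprocal of \<open>lomax_alpha n x \<sigma>\<close>.\<close>

definition mean_log :: "nat \<Rightarrow> (nat \<Rightarrow> real) \<Rightarrow> real \<Rightarrow> real" where
  "mean_log n x \<sigma> = (\<Sum>i = 1..n. ln (1 + x i / \<sigma>)) / real n"

lemma mean_log_pos:
  assumes "n \<ge> 1" and "\<forall>i\<in>{1..n}. x i > 0" and "\<sigma> > 0"
  shows "mean_log n x \<sigma> > 0"
  unfolding mean_log_def using assms
  by (intro divide_pos_pos sum_pos ln_gt_zero) auto

lemma lomax_profile_loglik_mean_log:
  assumes "n \<ge> 1" and "\<forall>i\<in>{1..n}. x i > 0" and "\<sigma> > 0"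
  shows "lomax_profile_loglik n x \<sigma> = - ln (\<sigma> * mean_log n x \<sigma>) - 1 - mean_log n x \<sigma>"
proof -
  have "lomax_alpha n x \<sigma> = inverse (mean_log n x \<sigma>)"
    by (simp add: lomax_alpha_def mean_log_def)
  then show ?thesis
    using lomax_profile_loglik_eq[OF assms] mean_log_pos[OF assms] assms(3)
    by (simp add: ln_mult ln_div inverse_eq_divide)
qed

lemma continuous_on_mean_log:
  assumes "\<forall>i\<in>{1..n}. x i > 0"
  shows "continuous_on {0<..} (mean_log n x)"
proof -
  have "1 + x i / \<sigma> \<noteq> 0" if "i \<in> {1..n}" "\<sigma> > 0" for i \<sigma>
  proof -
    have "x i / \<sigma> > 0" using that assms by simp
    then show ?thesis by linarith
  qed
  then show ?thesis
    unfolding mean_log_def [abs_def]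
    \<comment> \<open>For \<open>n = 0\<close> the function is constantly 0; otherwise the divisor
      is nonzero.\<close>
    by (cases "n = 0") (auto intro!: continuous_intros)
qed

text \<open>A single summand already diverges, and the others are nonnegative.\<close>

lemma filterlim_mean_log_at_right_0:
  assumes "n \<ge> 1" and "\<forall>i\<in>{1..n}. x i > 0"
  shows "filterlim (mean_log n x) at_top (at_right 0)"
proof -
  have x1: "x 1 > 0" using assms by simp
  have n: "real n > 0" using assms(1) by simp
  have "filterlim (\<lambda>\<sigma>. ln (1 + x 1 / \<sigma>) / real n) at_top (at_right 0)"
    using x1 n by real_asymp
  moreover have "\<forall>\<^sub>F \<sigma> in at_right 0. ln (1 + x 1 / \<sigma>) / real n \<le> mean_log n x \<sigma>"
    using eventually_at_right_less[of "0::real"]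
  proof eventually_elim
    case (elim \<sigma>)
    have "ln (1 + x 1 / \<sigma>) \<le> (\<Sum>i = 1..n. ln (1 + x i / \<sigma>))"
      using assms elim by (intro member_le_sum ln_ge_zero) (auto intro: less_imp_le)
    then show ?case
      unfolding mean_log_def by (rule divide_right_mono) simp
  qed
  ultimately show ?thesis by (rule filterlim_at_top_mono)
qed

text \<open>Each \<open>ln \<sigma> + ln (1 + x i / \<sigma>)\<close> equals
  \<open>ln (\<sigma> + x i)\<close>. The bound is free of \<open>\<sigma>\<close>, so near 0 the
  divergence of \<open>- ln \<sigma>\<close> is absorbed by the mean.\<close>

lemma ln_add_mean_log_ge:
  assumes "n \<ge> 1" and "\<forall>i\<in>{1..n}. x i > 0" and "\<sigma> > 0"
  shows "(\<Sum>i = 1..n. ln (x i)) / real n \<le> ln \<sigma> + mean_log n x \<sigma>"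
proof -
  have "ln (x i) \<le> ln \<sigma> + ln (1 + x i / \<sigma>)" if "i \<in> {1..n}" for i
  proof -
    have "x i > 0" using that assms(2) by blast
    then have "ln \<sigma> + ln (1 + x i / \<sigma>) = ln (\<sigma> + x i)"
      using assms(3) by (subst ln_mult_pos [symmetric]) (auto simp: field_simps add_pos_pos)
    then show ?thesis using \<open>x i > 0\<close> assms(3) by simp
  qed
  then have "(\<Sum>i = 1..n. ln (x i)) \<le> (\<Sum>i = 1..n. ln \<sigma> + ln (1 + x i / \<sigma>))"
    by (rule sum_mono)
  then show ?thesis
    using assms(1) by (simp add: mean_log_def sum.distrib field_simps)
qed

lemma tendsto_mult_mean_log:
  assumes "\<forall>i\<in>{1..n}. x i > 0"
  shows "((\<lambda>\<sigma>. \<sigma> * mean_log n x \<sigma>) \<longlongrightarrow> sample_mean n x) at_top"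
proof -
  have "((\<lambda>\<sigma>. \<sigma> * ln (1 + y / \<sigma>)) \<longlongrightarrow> y) at_top" if "y > 0" for y :: real
    using that by real_asymp
  then have "((\<lambda>\<sigma>. 1 / real n * (\<Sum>i = 1..n. \<sigma> * ln (1 + x i / \<sigma>))) \<longlongrightarrow>
      1 / real n * (\<Sum>i = 1..n. x i)) at_top"
    using assms by (intro tendsto_mult tendsto_const tendsto_sum) auto
  then show ?thesis
    by (simp add: mean_log_def sample_mean_def sum_distrib_left [symmetric])
qed

text \<open>Termwise, this is the expansion of \<open>ln (1 + t)\<close> as t - t^2/2 + o(t^2) at
  \<open>t = x i / \<sigma>\<close>.\<close>

lemma tendsto_mult_mean_log_second_order:
  assumes "\<forall>i\<in>{1..n}. x i > 0"
  shows "((\<lambda>\<sigma>. \<sigma> * (\<sigma> * mean_log n x \<sigma> - sample_mean n x)) \<longlongrightarrow>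
    - (1 / real n * (\<Sum>i = 1..n. (x i)\<^sup>2)) / 2) at_top"
proof -
  have "((\<lambda>\<sigma>. \<sigma> * (\<sigma> * ln (1 + y / \<sigma>) - y)) \<longlongrightarrow> - (y\<^sup>2) / 2) at_top" if "y > 0" for y :: real
    using that by (real_asymp simp: power2_eq_square)
  then have "((\<lambda>\<sigma>. 1 / real n * (\<Sum>i = 1..n. \<sigma> * (\<sigma> * ln (1 + x i / \<sigma>) - x i))) \<longlongrightarrow>
      1 / real n * (\<Sum>i = 1..n. - ((x i)\<^sup>2) / 2)) at_top"
    using assms by (intro tendsto_mult tendsto_const tendsto_sum) auto
  moreover have "1 / real n * (\<Sum>i = 1..n. \<sigma> * (\<sigma> * ln (1 + x i / \<sigma>) - x i)) =
      \<sigma> * (\<sigma> * mean_log n x \<sigma> - sample_mean n x)" for \<sigma>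
    by (simp add: mean_log_def sample_mean_def sum_distrib_left [symmetric] sum_subtractf
        right_diff_distrib)
  moreover have "1 / real n * (\<Sum>i = 1..n. - ((x i)\<^sup>2) / 2) =
      - (1 / real n * (\<Sum>i = 1..n. (x i)\<^sup>2)) / 2"
    by (simp add: sum_negf sum_divide_distrib [symmetric])
  ultimately show ?thesis by simp
qed

lemma sample_mean_pos:
  assumes "n \<ge> 1" and "\<forall>i\<in>{1..n}. x i > 0"
  shows "sample_mean n x > 0"
  unfolding sample_mean_def using assms by (intro mult_pos_pos sum_pos) auto

lemma coeff_var_gt_1_imp:
  assumes "sample_mean n x > 0" and "coeff_var n x > 1"
  shows "1 / real n * (\<Sum>i = 1..n. (x i)\<^sup>2) > 2 * (sample_mean n x)\<^sup>2"
proof -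
  let ?v = "1 / real n * (\<Sum>i = 1..n. (x i)\<^sup>2) - (sample_mean n x)\<^sup>2"
  have less: "sample_mean n x < sqrt ?v"
    using assms by (simp add: coeff_var_def sample_sd_def)
  \<comment> \<open>\<open>sqrt\<close> is odd on the reals, so squaring it gives back
    \<open>?v\<close> only once \<open>?v\<close> is known to be nonnegative.\<close>
  then have "?v > 0" using assms(1) by (metis less_trans real_sqrt_gt_0_iff)
  moreover have "(sample_mean n x)\<^sup>2 < (sqrt ?v)\<^sup>2"
    using less assms(1) by (intro power_strict_mono) auto
  ultimately show ?thesis by simp
qed

text \<open>Splitting the logarithm of the product leaves
  \<open>- (ln \<sigma> + M \<sigma>)\<close>, which is bounded above, and
  \<open>- ln (M \<sigma>)\<close>, which tends to minus infinity.\<close>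

lemma filterlim_lomax_profile_loglik_at_right_0:
  assumes "n \<ge> 1" and "\<forall>i\<in>{1..n}. x i > 0"
  shows "filterlim (lomax_profile_loglik n x) at_bot (at_right 0)"
proof -
  define c where "c = (\<Sum>i = 1..n. ln (x i)) / real n"
  have "filterlim (\<lambda>y. - ln y - 1 - c) at_bot at_top" by real_asymp
  then have "filterlim (\<lambda>\<sigma>. - ln (mean_log n x \<sigma>) - 1 - c) at_bot (at_right 0)"
    by (rule filterlim_compose) (rule filterlim_mean_log_at_right_0[OF assms])
  moreover have "\<forall>\<^sub>F \<sigma> in at_right 0.
      lomax_profile_loglik n x \<sigma> \<le> - ln (mean_log n x \<sigma>) - 1 - c"
    using eventually_at_right_less[of "0::real"]
  proof eventually_elim
    case (elim \<sigma>)
    then show ?case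
      using ln_add_mean_log_ge[OF assms elim] mean_log_pos[OF assms elim]
      by (simp add: lomax_profile_loglik_mean_log[OF assms] ln_mult c_def)
  qed
  ultimately show ?thesis by (rule filterlim_at_bot_mono)
qed

lemma tendsto_lomax_profile_loglik_at_top:
  assumes "n \<ge> 1" and "\<forall>i\<in>{1..n}. x i > 0"
  shows "(lomax_profile_loglik n x \<longlongrightarrow> - ln (sample_mean n x) - 1) at_top"
proof -
  have lim: "((\<lambda>\<sigma>. \<sigma> * mean_log n x \<sigma>) \<longlongrightarrow> sample_mean n x) at_top"
    using assms(2) by (rule tendsto_mult_mean_log)
  \<comment> \<open>The mean itself vanishes at infinity, being a null factor times a convergent
    one.\<close>
  have "((\<lambda>\<sigma>. inverse \<sigma> * (\<sigma> * mean_log n x \<sigma>)) \<longlongrightarrow> 0 * sample_mean n x) at_top"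
    by (intro tendsto_mult lim tendsto_inverse_0_at_top filterlim_ident)
  moreover have ev: "\<forall>\<^sub>F \<sigma>::real in at_top. \<sigma> > 0" by (rule eventually_gt_at_top)
  then have "\<forall>\<^sub>F \<sigma> in at_top. inverse \<sigma> * (\<sigma> * mean_log n x \<sigma>) = mean_log n x \<sigma>"
    by eventually_elim simp
  ultimately have "(mean_log n x \<longlongrightarrow> 0 * sample_mean n x) at_top"
    by (rule Lim_transform_eventually)
  then have "((\<lambda>\<sigma>. - ln (\<sigma> * mean_log n x \<sigma>) - 1 - mean_log n x \<sigma>) \<longlongrightarrow>
      - ln (sample_mean n x) - 1 - 0 * sample_mean n x) at_top"
    using sample_mean_pos[OF assms] by (intro tendsto_intros lim) auto
  moreover have "\<forall>\<^sub>F \<sigma> in at_top. - ln (\<sigma> * mean_log n x \<sigma>) - 1 - mean_log n x \<sigma> =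
      lomax_profile_loglik n x \<sigma>"
    using ev by eventually_elim (simp add: lomax_profile_loglik_mean_log[OF assms])
  ultimately show ?thesis
    using Lim_transform_eventually by fastforce
qed

lemma lomax_profile_loglik_exceeds_limit:
  assumes "n \<ge> 1" and "\<forall>i\<in>{1..n}. x i > 0" and "coeff_var n x > 1"
  shows "\<exists>\<sigma>>0. lomax_profile_loglik n x \<sigma> > - ln (sample_mean n x) - 1"
proof -
  define \<mu> where "\<mu> = sample_mean n x"
  define q where "q = 1 / real n * (\<Sum>i = 1..n. (x i)\<^sup>2)"
  define M where "M = mean_log n x"
  have \<mu>: "\<mu> > 0" unfolding \<mu>_def using assms(1,2) by (rule sample_mean_pos)
  have q: "q > 2 * \<mu>\<^sup>2"
    using coeff_var_gt_1_imp \<mu> assms(3) by (simp add: q_def \<mu>_def)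
  \<comment> \<open>The expression is \<open>\<sigma>\<close> times
    \<open>1 - \<sigma> * M \<sigma> / \<mu> - M \<sigma>\<close>, a lower bound for the excess of
    the profile over its limit.\<close>
  have "((\<lambda>\<sigma>. - (\<sigma> * (\<sigma> * M \<sigma> - \<mu>)) / \<mu> - \<sigma> * M \<sigma>) \<longlongrightarrow> - (- q / 2) / \<mu> - \<mu>) at_top"
    unfolding M_def \<mu>_def q_def
    by (intro tendsto_diff tendsto_divide tendsto_minus tendsto_const
        tendsto_mult_mean_log_second_order tendsto_mult_mean_log assms(2))
      (use \<mu> in \<open>simp add: \<mu>_def\<close>)
  \<comment> \<open>Here the condition on the coefficient of variation enters, in the form
    \<open>q > 2 * \<mu>\<^sup>2\<close>.\<close>
  moreover have "- (- q / 2) / \<mu> - \<mu> > 0"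
    using q \<mu> by (simp add: field_simps power2_eq_square)
  ultimately have "\<forall>\<^sub>F \<sigma> in at_top. - (\<sigma> * (\<sigma> * M \<sigma> - \<mu>)) / \<mu> - \<sigma> * M \<sigma> > 0"
    by (rule order_tendstoD)
  then have "\<forall>\<^sub>F \<sigma> in at_top. \<sigma> > 0 \<and> - (\<sigma> * (\<sigma> * M \<sigma> - \<mu>)) / \<mu> - \<sigma> * M \<sigma> > 0"
    using eventually_gt_at_top[of 0] by eventually_elim auto
  then obtain \<sigma> where \<sigma>: "\<sigma> > 0" "- (\<sigma> * (\<sigma> * M \<sigma> - \<mu>)) / \<mu> - \<sigma> * M \<sigma> > 0"
    using eventually_happens'[OF trivial_limit_at_top_linorder] by blast
  have M: "M \<sigma> > 0" unfolding M_def using assms(1,2) \<sigma>(1) by (rule mean_log_pos)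
  have "- (\<sigma> * (\<sigma> * M \<sigma> - \<mu>)) / \<mu> - \<sigma> * M \<sigma> = \<sigma> * (1 - \<sigma> * M \<sigma> / \<mu> - M \<sigma>)"
    using \<mu> by (simp add: field_simps)
  then have "1 - \<sigma> * M \<sigma> / \<mu> - M \<sigma> > 0"
    using \<sigma> by (simp add: zero_less_mult_iff)
  \<comment> \<open>This linear bound gives the inequality in the needed direction, so the outer
    logarithm need not be expanded.\<close>
  moreover have "ln (\<sigma> * M \<sigma> / \<mu>) \<le> \<sigma> * M \<sigma> / \<mu> - 1"
    using \<sigma>(1) M \<mu> by (intro ln_le_minus_one) simp
  moreover have "ln (\<sigma> * M \<sigma> / \<mu>) = ln (\<sigma> * M \<sigma>) - ln \<mu>"
    using \<sigma>(1) M \<mu> by (simp add: ln_div)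
  ultimately have "- ln (\<sigma> * M \<sigma>) - 1 - M \<sigma> > - ln \<mu> - 1"
    by linarith
  then show ?thesis
    using \<sigma>(1) by (auto simp: lomax_profile_loglik_mean_log[OF assms(1,2)] M_def \<mu>_def)
qed

theorem corollary1:
  fixes n :: nat and x :: "nat \<Rightarrow> real"
  assumes "n \<ge> 1"
    and "\<forall>i \<in> {1..n}. x i > 0"
    and "coeff_var n x > 1"
  shows "\<exists>\<sigma>\<^sub>0 \<in> {0<..}. \<forall>\<sigma> \<in> {0<..}.
    lomax_profile_loglik n x \<sigma> \<le> lomax_profile_loglik n x \<sigma>\<^sub>0"
proof -
  let ?f = "lomax_profile_loglik n x"
  obtain a where a: "a > 0" "?f a > - ln (sample_mean n x) - 1"
    using lomax_profile_loglik_exceeds_limit[OF assms] by blast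
  have "continuous_on {0<..} (\<lambda>\<sigma>. - ln (\<sigma> * mean_log n x \<sigma>) - 1 - mean_log n x \<sigma>)"
    using mean_log_pos[OF assms(1,2)]
    by (intro continuous_intros continuous_on_mean_log assms(2))
      (auto simp: less_imp_neq [symmetric])
  then have "continuous_on {0<..} ?f"
    by (rule continuous_on_eq) (simp add: lomax_profile_loglik_mean_log[OF assms(1,2)])
  moreover have "\<forall>\<^sub>F \<sigma> in at_right 0. ?f \<sigma> \<le> ?f a"
    using filterlim_lomax_profile_loglik_at_right_0[OF assms(1,2)]
    by (simp add: filterlim_at_bot)
  \<comment> \<open>The value at \<open>a\<close> exceeds the limit strictly, so the profile
    eventually falls below it.\<close>
  moreover have "\<forall>\<^sub>F \<sigma> in at_top. ?f \<sigma> \<le> ?f a"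
    using order_tendstoD(2)[OF tendsto_lomax_profile_loglik_at_top[OF assms(1,2)] a(2)]
    by (rule eventually_mono) simp
  ultimately show ?thesis
    using a(1) by (intro continuous_attains_sup_greaterThan)
qed

end
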